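(* Let $\mathbf{n}=(n_1,\ldots,n_d)\in\mathbb{N}^d$ have pairwise relatively prime entries, and let $P:[-1,1]^d\to\mathbb{C}$ be a $d$-variate polynomial function. Suppose that $\langle P,T_{\boldsymbol{\gamma}}\rangle=0$ for all $\boldsymbol{\gamma}\in\mathbb{N}_0^d\setminus\{\mathbf{0}\}$ for which there exists $\mathbf{h}\in\mathbb{N}_0^d$ with $\gamma_i=h_in_i$ for $i=1,\ldots,d$ and $\sum_{i=1}^dh_i\in 2\mathbb{N}_0$. Then $$\frac{1}{\pi^d}\int_{[-1,1]^d}P(\mathbf{x})\,w_d(\mathbf{x})\,d\mathbf{x}=\sum_{\mathbf{i}\in I^{(\mathbf{n})}}\mathfrak{w}^{(\mathbf{n})}_{\mathbf{i}}\,P(\mathbf{z}^{(\mathbf{n})}_{\mathbf{i}}).$$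
   Context: $\mathbb{N}=\{1,2,\ldots\}$, $\mathbb{N}_0=\mathbb{N}\cup\{0\}$, $d\in\mathbb{N}$, $p[\mathbf{n}]=\prod_{j=1}^dn_j$. $T_{\boldsymbol{\gamma}}(\mathbf{x})=\prod_{i=1}^dT_{\gamma_i}(x_i)$ with $T_\gamma(x)=\cos(\gamma\arccos x)$. $w_d(\mathbf{x})=\prod_{i=1}^d(1-x_i^2)^{-1/2}$ and $\langle f,g\rangle=\frac{1}{\pi^d}\int_{[-1,1]^d}f(\mathbf{x})\overline{g(\mathbf{x})}w_d(\mathbf{x})\,d\mathbf{x}$. For $\mathfrak{r}\in\{0,1\}$ let $I^{(\mathbf{n})}_{\mathfrak{r}}$ be the set of all $\mathbf{i}\in\mathbb{N}_0^d$ with $0\le i_j\le n_j$ and $i_j\equiv\mathfrak{r}\bmod 2$ for all $j$, and $I^{(\mathbf{n})}=I^{(\mathbf{n})}_0\cup I^{(\mathbf{n})}_1$. For $\mathbf{i}\in I^{(\mathbf{n})}$, $\mathbf{z}^{(\mathbf{n})}_{\mathbf{i}}=(\cos(i_1\pi/n_1),\ldots,\cos(i_d\pi/n_d))$ and $\mathfrak{w}^{(\mathbf{n})}_{\mathbf{i}}=2^{\#M}/(2p[\mathbf{n}])$, where $M=\{j\mid 0<i_j<n_j\}$. *)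

theory Defs
  imports "HOL-Analysis.Analysis" "HOL-Number_Theory.Cong"
begin

text \<open>The dimension \<open>d\<close> is the cardinality of the finite (hence nonempty) index type \<open>'d\<close>.\<close>

definition cube :: "(real ^ 'd) set" where
  "cube = {x. \<forall>j. -1 \<le> x $ j \<and> x $ j \<le> 1}"

definition cheb :: "nat \<Rightarrow> real \<Rightarrow> real" where
  "cheb k x = cos (real k * arccos x)"

definition cheb_prod :: "nat ^ 'd \<Rightarrow> real ^ 'd \<Rightarrow> real" where
  "cheb_prod \<gamma> x = (\<Prod>j\<in>UNIV. cheb (\<gamma> $ j) (x $ j))"

text \<open>On the faces of the cube, a null set, the weight is infinite; here \<open>0 powr a = 0\<close>.\<close>

definition cheb_weight :: "real ^ 'd \<Rightarrow> real" where
  "cheb_weight x = (\<Prod>j\<in>UNIV. (1 - (x $ j)\<^sup>2) powr (- 1 / 2))"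

definition cheb_inner :: "(real ^ 'd \<Rightarrow> complex) \<Rightarrow> (real ^ 'd \<Rightarrow> complex) \<Rightarrow> complex" where
  "cheb_inner f g =
     complex_of_real (1 / pi ^ CARD('d)) *
       (LINT x:cube|lborel. f x * cnj (g x) * complex_of_real (cheb_weight x))"

definition node_idx_par :: "nat \<Rightarrow> nat ^ 'd \<Rightarrow> (nat ^ 'd) set" where
  "node_idx_par r n = {i. \<forall>j. i $ j \<le> n $ j \<and> [i $ j = r] (mod 2)}"

definition node_idx :: "nat ^ 'd \<Rightarrow> (nat ^ 'd) set" where
  "node_idx n = node_idx_par 0 n \<union> node_idx_par 1 n"

definition node :: "nat ^ 'd \<Rightarrow> nat ^ 'd \<Rightarrow> real ^ 'd" where
  "node n i = (\<chi> j. cos (real (i $ j) * pi / real (n $ j)))"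

definition node_weight :: "nat ^ 'd \<Rightarrow> nat ^ 'd \<Rightarrow> real" where
  "node_weight n i =
     2 ^ card {j. 0 < i $ j \<and> i $ j < n $ j} / (2 * (\<Prod>j\<in>UNIV. real (n $ j)))"

end

theory Submission
  imports Defs
begin

text \<open>
  On the cube, \<open>P\<close> is a finite linear combination of the products \<open>T\<^sub>\<gamma>\<close>, so by orthogonality the left
  hand side is the coefficient of \<open>T\<^sub>0\<close>, and the hypothesis on \<open>P\<close> says that the coefficients at all
  other \<open>\<gamma> = (h\<^sub>i n\<^sub>i)\<close> with \<open>h\<^sub>1 + \<dots> + h\<^sub>d\<close> even vanish. The node sum of \<open>T\<^sub>\<gamma>\<close> over each parity class
  factorizes into one-dimensional cosine sums. The class \<open>r\<close> contributes \<open>(-1)\<close> to the power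
  \<open>r (h\<^sub>1 + \<dots> + h\<^sub>d)\<close>, divided by 2, if every \<open>n\<^sub>i\<close> divides \<open>\<gamma>\<^sub>i\<close>, and 0 otherwise. Hence the cubature
  sum is 1 for \<open>\<gamma> = 0\<close> and for those \<open>\<gamma>\<close>, and 0 for all the others.
\<close>

subsection \<open>Orthogonality\<close>

lemma cheb_0 [simp]: "cheb 0 x = 1"
  by (simp add: cheb_def)

lemma cheb_1: "\<bar>x\<bar> \<le> 1 \<Longrightarrow> cheb 1 x = x"
  by (simp add: cheb_def cos_arccos_abs)

text \<open>The product-to-sum formula for cosines. The absolute value keeps the second index in
  \<open>nat\<close>, which is harmless because cosine is even.\<close>

lemma cheb_mult:
  "cheb k x * cheb l x = (cheb (k + l) x + cheb (nat \<bar>int k - int l\<bar>) x) / 2"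
proof -
  have "cos (real (nat \<bar>int k - int l\<bar>) * arccos x) = cos (real k * arccos x - real l * arccos x)"
  proof (cases "l \<le> k")
    case True
    then show ?thesis
      by (simp add: left_diff_distrib of_nat_diff)
  next
    case False
    then have "real (nat \<bar>int k - int l\<bar>) * arccos x = - (real k * arccos x - real l * arccos x)"
      by (simp add: left_diff_distrib of_nat_diff)
    then show ?thesis
      by (simp only: cos_minus)
  qed
  then show ?thesis
    by (simp add: cheb_def cos_times_cos distrib_right)
qed

lemma abs_cheb_le_1: "\<bar>cheb k x\<bar> \<le> 1"
  by (simp add: cheb_def)

lemma continuous_on_cheb: "continuous_on {-1..1} (cheb k)"
  unfolding cheb_def by (intro continuous_intros) auto

text \<open>Since \<open>arccos\<close> has derivative \<open>- 1 / sqrt (1 - x^2)\<close>, an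
  antiderivative \<open>F\<close> is explicit. The weight is unbounded near both endpoints, so the
  fundamental theorem is used in the form that needs continuity on the closed interval but
  derivatives only inside.\<close>

lemma cheb_weighted_has_integral:
  "((\<lambda>x. cheb k x * (1 - x\<^sup>2) powr (- 1 / 2)) has_integral (if k = 0 then pi else 0)) {-1..1}"
proof -
  define F where "F = (\<lambda>x. if k = 0 then - arccos x else - sin (real k * arccos x) / real k)"
  have "((\<lambda>x. cheb k x * (1 - x\<^sup>2) powr (- 1 / 2)) has_integral (F 1 - F (-1))) {-1..1}"
  proof (rule fundamental_theorem_of_calculus_interior)
    show "continuous_on {-1..1} F"
      by (cases "k = 0") (auto simp: F_def intro!: continuous_intros)
  next
    fix x :: real
    assume x: "x \<in> {-1<..<1}"
    then have pos: "0 < 1 - x\<^sup>2"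
      using abs_square_less_1[of x] by auto
    have w: "(1 - x\<^sup>2) powr (- 1 / 2) = inverse (sqrt (1 - x\<^sup>2))"
      using pos powr_minus[of "1 - x\<^sup>2" "1 / 2"] by (simp add: powr_half_sqrt)
    have "(F has_real_derivative cheb k x * (1 - x\<^sup>2) powr (- 1 / 2)) (at x)"
      unfolding w
      by (cases "k = 0") (use x pos in \<open>auto simp: F_def cheb_def intro!: derivative_eq_intros\<close>)
    then show "(F has_vector_derivative cheb k x * (1 - x\<^sup>2) powr (- 1 / 2)) (at x)"
      by (simp add: has_real_derivative_iff_has_vector_derivative)
  qed simp
  moreover have "F 1 - F (-1) = (if k = 0 then pi else 0)"
    by (simp add: F_def)
  ultimately show ?thesis
    by simp
qed

text \<open>The weight alone is nonnegative with a finite integral (the case \<open>k = 0\<close>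
  above), hence absolutely integrable. It dominates the integrand because \<open>cheb k\<close> is
  bounded by 1.\<close>

lemma cheb_weighted_integrable:
  "set_integrable lborel {-1..1} (\<lambda>x. cheb k x * (1 - x\<^sup>2) powr (- 1 / 2))"
proof -
  have w: "set_integrable lborel {-1..1} (\<lambda>x::real. (1 - x\<^sup>2) powr (- 1 / 2))"
  proof -
    have "(\<lambda>x::real. (1 - x\<^sup>2) powr (- 1 / 2)) absolutely_integrable_on {-1..1}"
      by (rule nonnegative_absolutely_integrable_1)
        (use cheb_weighted_has_integral[of 0] in auto)
    then show ?thesis
      unfolding set_integrable_def by (subst (asm) integrable_completion) simp_all
  qed
  \<comment> \<open>Continuity of \<open>cheb k\<close> is available only on \<open>{-1..1}\<close>,
    so measurability is proved with the indicator attached.\<close>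
  have m: "(\<lambda>x. indicator {-1..1} x *\<^sub>R cheb k x) \<in> borel_measurable borel"
    by (rule borel_measurable_continuous_on_indicator) (simp_all add: continuous_on_cheb)
  have m2: "(\<lambda>x. (indicator {-1..1} x *\<^sub>R cheb k x) * (1 - x\<^sup>2) powr (- 1 / 2)) \<in> borel_measurable lborel"
    using m by measurable
  show ?thesis
    unfolding set_integrable_def
  proof (rule Bochner_Integration.integrable_bound[OF w[unfolded set_integrable_def]])
    show "(\<lambda>x. indicat_real {-1..1} x *\<^sub>R (cheb k x * (1 - x\<^sup>2) powr (- 1 / 2))) \<in> borel_measurable lborel"
      using m2 by (simp add: mult.assoc)
    show "AE x in lborel. norm (indicat_real {-1..1} x *\<^sub>R (cheb k x * (1 - x\<^sup>2) powr (- 1 / 2)))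
        \<le> norm (indicat_real {-1..1} x *\<^sub>R (1 - x\<^sup>2) powr (- 1 / 2))"
      by (intro AE_I2) (simp add: abs_mult abs_cheb_le_1 mult_left_le_one_le mult_left_le indicator_def)
  qed
qed

lemma cheb_weighted_integral:
  "(LINT x:{-1..1}|lborel. cheb k x * (1 - x\<^sup>2) powr (- 1 / 2)) = (if k = 0 then pi else 0)"
  using set_borel_integral_eq_integral(2)[OF cheb_weighted_integrable]
    integral_unique[OF cheb_weighted_has_integral] by simp

lemma cheb_mult_weighted_eq:
  "cheb k x * cheb l x * (1 - x\<^sup>2) powr (- 1 / 2) =
     (cheb (k + l) x * (1 - x\<^sup>2) powr (- 1 / 2)
      + cheb (nat \<bar>int k - int l\<bar>) x * (1 - x\<^sup>2) powr (- 1 / 2)) / 2"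
  by (simp add: cheb_mult algebra_simps add_divide_distrib)

lemma cheb_mult_weighted_integrable:
  "set_integrable lborel {-1..1} (\<lambda>x. cheb k x * cheb l x * (1 - x\<^sup>2) powr (- 1 / 2))"
  unfolding cheb_mult_weighted_eq
  by (intro set_integrable_divide set_integral_add cheb_weighted_integrable)

text \<open>Only index 0 has a nonzero integral. The difference index is 0 exactly for
  \<open>k = l\<close>, the sum index exactly for \<open>k = l = 0\<close>.\<close>

lemma cheb_mult_weighted_integral:
  "(LINT x:{-1..1}|lborel. cheb k x * cheb l x * (1 - x\<^sup>2) powr (- 1 / 2)) =
     (if k \<noteq> l then 0 else if k = 0 then pi else pi / 2)"
  unfolding cheb_mult_weighted_eq set_integral_divide_zero
    set_integral_add(2)[OF cheb_weighted_integrable cheb_weighted_integrable]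
    cheb_weighted_integral
  by simp

text \<open>Fubini for tensor products: \<open>lborel\<close> on vectors is the image of a product
  measure indexed by \<open>Basis\<close>, and the basis vectors \<open>axis j 1\<close> correspond
  to the coordinates \<open>j\<close>.\<close>

lemma integral_prod_vec:
  fixes f :: "'d::finite \<Rightarrow> real \<Rightarrow> real"
  assumes f: "\<And>j. integrable lborel (f j)"
  shows "integrable lborel (\<lambda>x::real^'d. \<Prod>j\<in>UNIV. f j (x $ j))"
    and "(LINT x|lborel. (\<Prod>j\<in>UNIV. f j ((x::real^'d) $ j))) = (\<Prod>j\<in>UNIV. LINT x|lborel. f j x)"
proof -
  interpret product_sigma_finite "\<lambda>_::real^'d. lborel :: real measure" ..
  have inj: "inj (\<lambda>j::'d. axis j (1::real))"
    by (auto simp: inj_def axis_eq_axis)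
  have Basis: "(Basis :: (real^'d) set) = range (\<lambda>j. axis j 1)"
    by (auto simp: Basis_vec_def)
  \<comment> \<open>Reindexes the family \<open>f\<close> by basis vectors, to match the index set
    of the product measure.\<close>
  define g where "g = (\<lambda>b::real^'d. f (inv (\<lambda>j. axis j (1::real)) b))"
  have g_axis: "g (axis j 1) = f j" for j
    by (simp add: g_def inv_f_f[OF inj])
  have g: "integrable lborel (g b)" for b
    by (simp add: g_def f)
  have m [measurable]: "(\<lambda>x::real^'d. \<Prod>j\<in>UNIV. f j (x $ j)) \<in> borel_measurable borel"
  proof -
    have [measurable]: "f j \<in> borel_measurable borel" for j
      using f[of j] by auto
    have [measurable]: "(\<lambda>x::real^'d. x $ j) \<in> borel_measurable borel" for j
      by (intro borel_measurable_continuous_onI continuous_intros)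
    show ?thesis
      by measurable
  qed
  have eq: "(\<Prod>j\<in>UNIV. f j ((\<Sum>b\<in>Basis. h b *\<^sub>R b) $ j)) = (\<Prod>b\<in>Basis. g b (h b))"
    for h :: "real^'d \<Rightarrow> real"
  proof -
    have "(\<Sum>b\<in>Basis. h b *\<^sub>R b) $ j = h (axis j 1)" for j
      unfolding Basis sum.reindex[OF inj]
      by (simp add: axis_def if_distrib[of "(*) _"] cong: if_cong)
    then show ?thesis
      unfolding Basis by (simp add: prod.reindex[OF inj] g_axis)
  qed
  have T: "(\<lambda>h. \<Sum>b\<in>Basis. h b *\<^sub>R b) \<in> (\<Pi>\<^sub>M b\<in>(Basis :: (real^'d) set). lborel) \<rightarrow>\<^sub>M borel"
    by measurable
  show "integrable lborel (\<lambda>x::real^'d. \<Prod>j\<in>UNIV. f j (x $ j))"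
    unfolding lborel_eq[where 'a = "real^'d"] integrable_distr_eq[OF T m] eq
    by (intro product_integrable_prod g finite_Basis)
  have "(LINT x|lborel. (\<Prod>j\<in>UNIV. f j ((x::real^'d) $ j))) = (\<Prod>b\<in>Basis. LINT x|lborel. g b x)"
    unfolding lborel_eq[where 'a = "real^'d"] integral_distr[OF T m] eq
    by (intro product_integral_prod g finite_Basis)
  also have "\<dots> = (\<Prod>j\<in>UNIV. LINT x|lborel. f j x)"
    unfolding Basis by (simp add: prod.reindex[OF inj] g_axis)
  finally show "(LINT x|lborel. (\<Prod>j\<in>UNIV. f j ((x::real^'d) $ j))) = (\<Prod>j\<in>UNIV. LINT x|lborel. f j x)" .
qed

text \<open>Brings the integrand into the shape of \<open>integral_prod_vec\<close>: cube, weight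
  and Chebyshev products all factor over the coordinates.\<close>

lemma cheb_prod_integrand_eq:
  fixes x :: "real ^ 'd::finite"
  shows "indicator cube x *\<^sub>R (cheb_prod \<gamma> x * cheb_prod \<delta> x * cheb_weight x) =
    (\<Prod>j\<in>UNIV. indicator {-1..1} (x $ j) *\<^sub>R
       (cheb (\<gamma> $ j) (x $ j) * cheb (\<delta> $ j) (x $ j) * (1 - (x $ j)\<^sup>2) powr (- 1 / 2)))"
proof -
  have "(indicator cube x :: real) = (\<Prod>j\<in>UNIV. indicator {-1..1} (x $ j))"
    by (auto simp: cube_def indicator_def)
  then show ?thesis
    by (simp add: cheb_prod_def cheb_weight_def prod.distrib)
qed

lemma cheb_prod_integrable:
  "set_integrable lborel (cube :: (real ^ 'd::finite) set)
     (\<lambda>x. cheb_prod \<gamma> x * cheb_prod \<delta> x * cheb_weight x)"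
  unfolding set_integrable_def cheb_prod_integrand_eq
  by (intro integral_prod_vec cheb_mult_weighted_integrable[unfolded set_integrable_def])

lemma cheb_prod_integral:
  "(LINT x:(cube :: (real ^ 'd::finite) set)|lborel. cheb_prod \<gamma> x * cheb_prod \<delta> x * cheb_weight x) =
     (\<Prod>j\<in>UNIV. if \<gamma> $ j \<noteq> \<delta> $ j then 0 else if \<gamma> $ j = 0 then pi else pi / 2)"
  unfolding set_lebesgue_integral_def cheb_prod_integrand_eq
    cheb_mult_weighted_integral[unfolded set_lebesgue_integral_def, symmetric]
  by (intro integral_prod_vec cheb_mult_weighted_integrable[unfolded set_integrable_def])

subsection \<open>Node sums\<close>

text \<open>The angles are equally spaced and run over \<open>\<gamma>\<close> full turns. If
  \<open>n\<close> divides \<open>\<gamma>\<close>, each step is a multiple of a full turn and all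
  terms agree; otherwise the terms cancel.\<close>

lemma sum_cos_double:
  fixes n \<gamma> r :: nat
  assumes n: "1 \<le> n"
  shows "(\<Sum>m<n. cos (real \<gamma> * (real (2 * m + r) * pi / real n))) =
    (if n dvd \<gamma> then real n * (-1) ^ (r * (\<gamma> div n)) else 0)"
proof (cases "n dvd \<gamma>")
  case True
  then obtain h where h: "\<gamma> = n * h" ..
  have "cos (real \<gamma> * (real (2 * m + r) * pi / real n)) = (-1) ^ (r * h)" for m
  proof -
    have "real \<gamma> * (real (2 * m + r) * pi / real n) = real ((2 * m + r) * h) * pi"
      using n by (simp add: h)
    then have "cos (real \<gamma> * (real (2 * m + r) * pi / real n)) = (-1) ^ ((2 * m + r) * h)"
      by (simp only: cos_npi)
    then show ?thesis
      by (simp add: distrib_right power_add power_mult)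
  qed
  then show ?thesis
    using n True by (simp add: h)
next
  case False
  define \<theta> where "\<theta> = real \<gamma> * pi / real n"
  have "sin \<theta> \<noteq> 0"
  proof
    assume "sin \<theta> = 0"
    then obtain i :: int where i: "\<theta> = real_of_int i * pi"
      by (auto simp: sin_zero_iff_int2)
    then have "real \<gamma> = real_of_int i * real n"
      using n by (simp add: \<theta>_def field_simps)
    then have "real_of_int (int \<gamma>) = real_of_int (i * int n)"
      by simp
    then have "int \<gamma> = i * int n"
      by (simp only: of_int_eq_iff)
    then have "int n dvd int \<gamma>"
      by simp
    with False show False
      by simp
  qed
  define s where "s m = sin ((2 * real m + real r - 1) * \<theta>)" for m :: nat
  \<comment> \<open>multiplying the sum by \<open>2 * sin \<theta>\<close> makes it telescope\<close>
  have step: "2 * sin \<theta> * cos (real \<gamma> * (real (2 * m + r) * pi / real n)) = s (Suc m) - s m" for m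
  proof -
    have a: "real \<gamma> * (real (2 * m + r) * pi / real n) = (2 * real m + real r) * \<theta>"
      by (simp add: \<theta>_def)
    have b: "s (Suc m) = sin ((2 * real m + real r) * \<theta> + \<theta>)"
      "s m = sin ((2 * real m + real r) * \<theta> - \<theta>)"
      by (simp_all add: s_def algebra_simps)
    show ?thesis
      unfolding a b by (simp add: sin_add sin_diff)
  qed
  have "2 * sin \<theta> * (\<Sum>m<n. cos (real \<gamma> * (real (2 * m + r) * pi / real n))) = s n - s 0"
    by (simp only: sum_distrib_left step sum_lessThan_telescope)
  \<comment> \<open>Raising the index by \<open>n\<close> adds \<open>2 * n * \<theta>\<close>,
    which is \<open>\<gamma>\<close> full periods.\<close>
  also have "s n = s 0"
  proof -
    have "(2 * real n + real r - 1) * \<theta> = (real r - 1) * \<theta> + 2 * real \<gamma> * pi"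
      using n by (simp add: \<theta>_def field_simps)
    then show ?thesis
      unfolding s_def by (simp only: sin_add cos_2npi sin_2npi) simp
  qed
  finally show ?thesis
    using False \<open>sin \<theta> \<noteq> 0\<close> by simp
qed

text \<open>The interior nodes get weight 2 because \<open>k\<close> and \<open>2 * n - k\<close> have the same parity.\<close>

lemma sum_fold_parity:
  fixes g :: "nat \<Rightarrow> real"
  assumes n: "1 \<le> n" and r: "r \<in> {0, 1}"
    and g: "\<And>k. k \<le> 2 * n \<Longrightarrow> g (2 * n - k) = g k"
  shows "(\<Sum>k | k \<le> n \<and> [k = r] (mod 2). (if 0 < k \<and> k < n then 2 else 1) * g k) =
    (\<Sum>m<n. g (2 * m + r))"
proof -
  have par: "[2 * n - k = r] (mod 2) \<longleftrightarrow> [k = r] (mod 2)" if "k \<le> 2 * n" for k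
    using that by (simp add: cong_def mod2_eq_if)
  \<comment> \<open>As \<open>r\<close> is 0 or 1, \<open>2 * m + r\<close> runs exactly once
    through the numbers below \<open>2 * n\<close> of parity \<open>r\<close>.\<close>
  have "(\<Sum>m<n. g (2 * m + r)) = (\<Sum>k | k < 2 * n \<and> [k = r] (mod 2). g k)"
  proof (rule sum.reindex_bij_witness[of _ "\<lambda>k. k div 2" "\<lambda>m. 2 * m + r"])
    fix k
    assume "k \<in> {k. k < 2 * n \<and> [k = r] (mod 2)}"
    with r show "2 * (k div 2) + r = k" "k div 2 \<in> {..<n}"
      using mult_div_mod_eq[of 2 k] by (auto simp: cong_def)
  qed (use r in \<open>auto simp: cong_def\<close>)
  also have "{k. k < 2 * n \<and> [k = r] (mod 2)} =
      {k. k \<le> n \<and> [k = r] (mod 2)} \<union> {k. n < k \<and> k < 2 * n \<and> [k = r] (mod 2)}"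
    using n by auto
  also have "(\<Sum>k\<in>\<dots>. g k) = (\<Sum>k | k \<le> n \<and> [k = r] (mod 2). g k) +
      (\<Sum>k | n < k \<and> k < 2 * n \<and> [k = r] (mod 2). g k)"
    by (rule sum.union_disjoint) auto
  \<comment> \<open>The reflection \<open>k\<close> to \<open>2 * n - k\<close> folds the upper half
    onto the interior. The endpoints 0 and \<open>n\<close> acquire no partner: the mirror image of
    0 is out of range and \<open>n\<close> is fixed.\<close>
  also have "(\<Sum>k | n < k \<and> k < 2 * n \<and> [k = r] (mod 2). g k) =
      (\<Sum>k | 0 < k \<and> k < n \<and> [k = r] (mod 2). g k)"
    by (rule sum.reindex_bij_witness[of _ "\<lambda>k. 2 * n - k" "\<lambda>k. 2 * n - k"])
      (use g par in auto)
  also have "\<dots> = (\<Sum>k | k \<le> n \<and> [k = r] (mod 2). if 0 < k \<and> k < n then g k else 0)"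
    by (rule sum.mono_neutral_cong_left) auto
  also have "(\<Sum>k | k \<le> n \<and> [k = r] (mod 2). g k) + \<dots> =
      (\<Sum>k | k \<le> n \<and> [k = r] (mod 2). (if 0 < k \<and> k < n then 2 else 1) * g k)"
    unfolding sum.distrib[symmetric] by (rule sum.cong) auto
  finally show ?thesis
    by simp
qed

lemma sum_weighted_cheb_nodes:
  assumes n: "1 \<le> n" and r: "r \<in> {0, 1}"
  shows "(\<Sum>k | k \<le> n \<and> [k = r] (mod 2).
      (if 0 < k \<and> k < n then 2 else 1) * cheb \<gamma> (cos (real k * pi / real n))) =
    (if n dvd \<gamma> then real n * (-1) ^ (r * (\<gamma> div n)) else 0)"
proof -
  \<comment> \<open>Continues the node values of \<open>cheb\<close> to indices up to
    \<open>2 * n\<close>. Only for \<open>k \<le> n\<close> does the angle lie in the range where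
    \<open>arccos\<close> undoes \<open>cos\<close>.\<close>
  define g where "g k = cos (real \<gamma> * (real k * pi / real n))" for k :: nat
  have sym: "g (2 * n - k) = g k" if "k \<le> 2 * n" for k
  proof -
    have "real \<gamma> * (real (2 * n - k) * pi / real n) =
        - (real \<gamma> * (real k * pi / real n)) + 2 * real \<gamma> * pi"
      using n that by (simp add: of_nat_diff field_simps)
    moreover have "cos (- (real \<gamma> * (real k * pi / real n)) + 2 * real \<gamma> * pi) = g k"
      unfolding g_def by (simp only: cos_add cos_2npi sin_2npi) simp
    ultimately show ?thesis
      unfolding g_def by simp
  qed
  have "cheb \<gamma> (cos (real k * pi / real n)) = g k" if "k \<le> n" for k
  proof -
    have "real k * pi / real n \<le> pi"
      using n that by (simp add: field_simps)
    then show ?thesis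
      by (simp add: cheb_def g_def arccos_cos)
  qed
  then have "(\<Sum>k | k \<le> n \<and> [k = r] (mod 2).
      (if 0 < k \<and> k < n then 2 else 1) * cheb \<gamma> (cos (real k * pi / real n))) =
      (\<Sum>k | k \<le> n \<and> [k = r] (mod 2). (if 0 < k \<and> k < n then 2 else 1) * g k)"
    by (intro sum.cong) auto
  then show ?thesis
    using sum_fold_parity[OF n r, of g] sym sum_cos_double[OF n, of \<gamma> r] by (simp add: g_def)
qed

section \<open>Node sums in several variables\<close>

lemma sum_vec_prod:
  fixes f :: "'d::finite \<Rightarrow> 'b \<Rightarrow> 'c::comm_semiring_1"
  assumes "\<And>j. finite (B j)"
  shows "(\<Sum>i | \<forall>j. i $ j \<in> B j. \<Prod>j\<in>UNIV. f j (i $ j)) = (\<Prod>j\<in>UNIV. \<Sum>k\<in>B j. f j k)"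
proof -
  have "(\<Prod>j\<in>UNIV. \<Sum>k\<in>B j. f j k) = (\<Sum>g\<in>PiE UNIV B. \<Prod>j\<in>UNIV. f j (g j))"
    by (rule prod_sum_PiE) (simp_all add: assms)
  also have "\<dots> = (\<Sum>i | \<forall>j. i $ j \<in> B j. \<Prod>j\<in>UNIV. f j (i $ j))"
    by (rule sum.reindex_bij_witness[of _ vec_nth vec_lambda]) auto
  finally show ?thesis
    by simp
qed

lemma sum_node_idx_par_cheb_prod:
  fixes n \<gamma> :: "nat ^ 'd::finite"
  assumes n: "\<And>j. 1 \<le> n $ j" and r: "r \<in> {0, 1}"
  shows "(\<Sum>i\<in>node_idx_par r n. node_weight n i * cheb_prod \<gamma> (node n i)) =
    (if \<forall>j. n $ j dvd \<gamma> $ j then (-1) ^ (r * (\<Sum>j\<in>UNIV. \<gamma> $ j div n $ j)) / 2 else 0)"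
proof -
  define p where "p = (\<Prod>j\<in>UNIV. real (n $ j))"
  have "n $ j \<noteq> 0" for j
    using n[of j] by simp
  then have "p \<noteq> 0"
    by (simp add: p_def)
  define F where "F j k = (if 0 < k \<and> k < n $ j then 2 else 1) *
      cheb (\<gamma> $ j) (cos (real k * pi / real (n $ j)))" for j and k :: nat
  have w: "node_weight n i * cheb_prod \<gamma> (node n i) = (\<Prod>j\<in>UNIV. F j (i $ j)) / (2 * p)" for i
  proof -
    \<comment> \<open>The power of 2 in the node weight counts interior coordinates, so it splits
      into one factor 2 for each of them.\<close>
    have "(\<Prod>j\<in>UNIV. if 0 < i $ j \<and> i $ j < n $ j then 2 else 1 :: real) =
        2 ^ card {j. 0 < i $ j \<and> i $ j < n $ j}"
      by (subst prod.inter_filter[symmetric]) simp_all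
    then show ?thesis
      by (simp add: node_weight_def cheb_prod_def node_def F_def prod.distrib p_def)
  qed
  have "(\<Sum>i\<in>node_idx_par r n. \<Prod>j\<in>UNIV. F j (i $ j)) =
      (\<Prod>j\<in>UNIV. \<Sum>k | k \<le> n $ j \<and> [k = r] (mod 2). F j k)"
    unfolding node_idx_par_def
    using sum_vec_prod[of "\<lambda>j. {k. k \<le> n $ j \<and> [k = r] (mod 2)}" F] by simp
  also have "\<dots> = (\<Prod>j\<in>UNIV. if n $ j dvd \<gamma> $ j
      then real (n $ j) * (-1) ^ (r * (\<gamma> $ j div n $ j)) else 0)"
    unfolding F_def using sum_weighted_cheb_nodes[OF n r] by simp
  also have "\<dots> = (if \<forall>j. n $ j dvd \<gamma> $ j
      then p * (-1) ^ (r * (\<Sum>j\<in>UNIV. \<gamma> $ j div n $ j)) else 0)"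
    by (auto simp: prod.distrib p_def power_sum sum_distrib_left)
  finally show ?thesis
    using \<open>p \<noteq> 0\<close> by (simp add: w flip: sum_divide_distrib)
qed

text \<open>If all \<open>n $ j\<close> divide \<open>\<gamma> $ j\<close>, the even class gives 1/2
  and the odd class plus or minus 1/2, by the parity of the sum of the quotients. The two add up for
  an even sum and cancel for an odd one.\<close>

lemma sum_node_idx_cheb_prod:
  fixes n \<gamma> :: "nat ^ 'd::finite"
  assumes n: "\<And>j. 1 \<le> n $ j"
  shows "(\<Sum>i\<in>node_idx n. node_weight n i * cheb_prod \<gamma> (node n i)) =
    (if \<exists>h :: nat ^ 'd. (\<forall>j. \<gamma> $ j = h $ j * n $ j) \<and> even (\<Sum>j\<in>UNIV. h $ j) then 1 else 0)"
proof -
  have fin: "finite (node_idx_par r n)" for r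
  proof -
    have "finite (vec_lambda ` PiE UNIV (\<lambda>j. {..n $ j}))"
      by (intro finite_imageI finite_PiE) auto
    then show ?thesis
      by (rule finite_subset[rotated])
        (force simp: node_idx_par_def image_iff intro!: bexI[of _ "vec_nth _"])
  qed
  \<comment> \<open>The index type is nonempty, so there is a coordinate whose parity separates the
    classes.\<close>
  have disj: "node_idx_par 0 n \<inter> node_idx_par 1 n = {}"
    by (auto simp: node_idx_par_def cong_def)
  \<comment> \<open>Positivity of the \<open>n $ j\<close> forces \<open>h\<close> to consist of the
    quotients.\<close>
  have h: "(\<exists>h :: nat ^ 'd. (\<forall>j. \<gamma> $ j = h $ j * n $ j) \<and> even (\<Sum>j\<in>UNIV. h $ j)) \<longleftrightarrow>
      (\<forall>j. n $ j dvd \<gamma> $ j) \<and> even (\<Sum>j\<in>UNIV. \<gamma> $ j div n $ j)" (is "?L \<longleftrightarrow> ?R")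
  proof
    assume ?L
    then obtain h :: "nat ^ 'd" where h: "\<And>j. \<gamma> $ j = h $ j * n $ j" "even (\<Sum>j\<in>UNIV. h $ j)"
      by blast
    have "n $ j \<noteq> 0" for j
      using n[of j] by simp
    with h show ?R
      by simp
  next
    assume ?R
    then show ?L
      by (intro exI[of _ "\<chi> j. \<gamma> $ j div n $ j"]) simp
  qed
  show ?thesis
    unfolding h node_idx_def sum.union_disjoint[OF fin fin disj]
    by (subst (1 2) sum_node_idx_par_cheb_prod) (use n in auto)
qed

subsection \<open>Chebyshev expansions of polynomials\<close>

text \<open>Equality is demanded on the cube only, because \<open>cheb\<close>, defined through
  \<open>arccos\<close>, is matched with polynomials only there.\<close>

definition cheb_span :: "(real ^ 'd \<Rightarrow> complex) set" where
  "cheb_span = {f. \<exists>A c. finite A \<and>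
     (\<forall>x\<in>cube. f x = (\<Sum>\<gamma>\<in>A. c \<gamma> * complex_of_real (cheb_prod \<gamma> x)))}"

lemma cheb_span_cheb_prod: "(\<lambda>x. complex_of_real (cheb_prod \<gamma> x)) \<in> cheb_span"
  unfolding cheb_span_def by (rule CollectI, intro exI[of _ "{\<gamma>}"] exI[of _ "\<lambda>_. 1"]) simp

lemma cheb_span_0: "(\<lambda>x. 0) \<in> cheb_span"
  unfolding cheb_span_def by (rule CollectI, intro exI[of _ "{}"]) simp

lemma cheb_span_cmult: "f \<in> cheb_span \<Longrightarrow> (\<lambda>x. a * f x) \<in> cheb_span"
  unfolding cheb_span_def
proof safe
  fix A c
  assume "finite A" "\<forall>x\<in>cube. f x = (\<Sum>\<gamma>\<in>A. c \<gamma> * complex_of_real (cheb_prod \<gamma> x))"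
  then show "\<exists>A c. finite A \<and>
      (\<forall>x\<in>cube. a * f x = (\<Sum>\<gamma>\<in>A. c \<gamma> * complex_of_real (cheb_prod \<gamma> x)))"
    by (intro exI[of _ A] exI[of _ "\<lambda>\<gamma>. a * c \<gamma>"]) (simp add: sum_distrib_left mult.assoc)
qed

lemma cheb_span_add:
  assumes "f \<in> cheb_span" "g \<in> cheb_span"
  shows "(\<lambda>x. f x + g x) \<in> cheb_span"
proof -
  obtain A c where A: "finite A"
    "\<And>x. x \<in> cube \<Longrightarrow> f x = (\<Sum>\<gamma>\<in>A. c \<gamma> * complex_of_real (cheb_prod \<gamma> x))"
    using assms(1) by (auto simp: cheb_span_def)
  obtain B e where B: "finite B"
    "\<And>x. x \<in> cube \<Longrightarrow> g x = (\<Sum>\<gamma>\<in>B. e \<gamma> * complex_of_real (cheb_prod \<gamma> x))"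
    using assms(2) by (auto simp: cheb_span_def)
  \<comment> \<open>Both coefficient families are extended by 0 to the union, so that they add on
    the overlap of \<open>A\<close> and \<open>B\<close>.\<close>
  define u where "u \<gamma> = (if \<gamma> \<in> A then c \<gamma> else 0) + (if \<gamma> \<in> B then e \<gamma> else 0)" for \<gamma>
  have "f x + g x = (\<Sum>\<gamma>\<in>A \<union> B. u \<gamma> * complex_of_real (cheb_prod \<gamma> x))" if "x \<in> cube" for x
  proof -
    have "f x = (\<Sum>\<gamma>\<in>A \<union> B. (if \<gamma> \<in> A then c \<gamma> else 0) * complex_of_real (cheb_prod \<gamma> x))"
      unfolding A(2)[OF that] by (rule sum.mono_neutral_cong_left) (use A(1) B(1) in auto)
    moreover have "g x = (\<Sum>\<gamma>\<in>A \<union> B. (if \<gamma> \<in> B then e \<gamma> else 0) * complex_of_real (cheb_prod \<gamma> x))"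
      unfolding B(2)[OF that] by (rule sum.mono_neutral_cong_left) (use A(1) B(1) in auto)
    ultimately show ?thesis
      by (simp add: u_def distrib_right sum.distrib)
  qed
  then show ?thesis
    using A(1) B(1) unfolding cheb_span_def by blast
qed

lemma cheb_span_sum:
  "(\<And>i. i \<in> I \<Longrightarrow> f i \<in> cheb_span) \<Longrightarrow> (\<lambda>x. \<Sum>i\<in>I. f i x) \<in> cheb_span"
  by (induction I rule: infinite_finite_induct) (auto intro: cheb_span_0 cheb_span_add)

lemma cheb_span_cong:
  "f \<in> cheb_span \<Longrightarrow> (\<And>x. x \<in> cube \<Longrightarrow> g x = f x) \<Longrightarrow> g \<in> cheb_span"
  by (auto simp: cheb_span_def)

text \<open>Expands the coordinatewise product formula. The set \<open>X\<close> collects the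
  coordinates where the sum index is chosen; the others take the difference index.\<close>

lemma cheb_prod_mult:
  fixes \<gamma> \<delta> :: "nat ^ 'd::finite"
  shows "cheb_prod \<gamma> x * cheb_prod \<delta> x = (\<Sum>X\<in>UNIV. 1 / 2 ^ CARD('d) *
    cheb_prod (\<chi> j. if j \<in> X then \<gamma> $ j + \<delta> $ j else nat \<bar>int (\<gamma> $ j) - int (\<delta> $ j)\<bar>) x)"
proof -
  define a where "a j = cheb (\<gamma> $ j + \<delta> $ j) (x $ j)" for j
  define b where "b j = cheb (nat \<bar>int (\<gamma> $ j) - int (\<delta> $ j)\<bar>) (x $ j)" for j
  have "cheb_prod \<gamma> x * cheb_prod \<delta> x = (\<Prod>j\<in>UNIV. (a j + b j) / 2)"
    by (simp add: cheb_prod_def cheb_mult a_def b_def flip: prod.distrib)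
  also have "\<dots> = (\<Prod>j\<in>UNIV. a j + b j) / 2 ^ CARD('d)"
    by (simp add: prod_dividef)
  also have "(\<Prod>j\<in>UNIV. a j + b j) = (\<Sum>X\<in>UNIV. (\<Prod>j\<in>X. a j) * (\<Prod>j\<in>UNIV - X. b j))"
    by (subst prod_add) simp_all
  also have "\<dots> = (\<Sum>X\<in>UNIV.
      cheb_prod (\<chi> j. if j \<in> X then \<gamma> $ j + \<delta> $ j else nat \<bar>int (\<gamma> $ j) - int (\<delta> $ j)\<bar>) x)"
  proof (rule sum.cong[OF refl])
    fix X :: "'d set"
    have "(\<Prod>j\<in>X. a j) * (\<Prod>j\<in>UNIV - X. b j) = (\<Prod>j\<in>UNIV. if j \<in> X then a j else b j)"
      by (simp add: prod.If_cases Compl_eq_Diff_UNIV)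
    also have "\<dots> = cheb_prod
        (\<chi> j. if j \<in> X then \<gamma> $ j + \<delta> $ j else nat \<bar>int (\<gamma> $ j) - int (\<delta> $ j)\<bar>) x"
      unfolding cheb_prod_def a_def b_def by (rule prod.cong) auto
    finally show "(\<Prod>j\<in>X. a j) * (\<Prod>j\<in>UNIV - X. b j) = \<dots>" .
  qed
  finally show ?thesis
    by (simp add: sum_divide_distrib)
qed

lemma cheb_span_mult:
  fixes f g :: "real ^ 'd::finite \<Rightarrow> complex"
  assumes "f \<in> cheb_span" "g \<in> cheb_span"
  shows "(\<lambda>x. f x * g x) \<in> cheb_span"
proof -
  obtain A c where A:
    "\<And>x. x \<in> cube \<Longrightarrow> f x = (\<Sum>\<gamma>\<in>A. c \<gamma> * complex_of_real (cheb_prod \<gamma> x))"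
    using assms(1) by (auto simp: cheb_span_def)
  obtain B e where B:
    "\<And>x. x \<in> cube \<Longrightarrow> g x = (\<Sum>\<gamma>\<in>B. e \<gamma> * complex_of_real (cheb_prod \<gamma> x))"
    using assms(2) by (auto simp: cheb_span_def)
  have basis: "(\<lambda>x. complex_of_real (cheb_prod \<gamma> x * cheb_prod \<delta> x)) \<in> cheb_span"
    for \<gamma> \<delta> :: "nat ^ 'd"
    unfolding cheb_prod_mult of_real_sum of_real_mult[of "1 / 2 ^ CARD('d)"]
    by (intro cheb_span_sum cheb_span_cmult cheb_span_cheb_prod)
  show ?thesis
  proof (rule cheb_span_cong)
    show "(\<lambda>x. \<Sum>\<gamma>\<in>A. \<Sum>\<delta>\<in>B. (c \<gamma> * e \<delta>) * complex_of_real (cheb_prod \<gamma> x * cheb_prod \<delta> x))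
        \<in> cheb_span"
      by (intro cheb_span_sum cheb_span_cmult basis)
    show "f x * g x =
        (\<Sum>\<gamma>\<in>A. \<Sum>\<delta>\<in>B. (c \<gamma> * e \<delta>) * complex_of_real (cheb_prod \<gamma> x * cheb_prod \<delta> x))"
      if "x \<in> cube" for x
      unfolding A[OF that] B[OF that] by (simp add: sum_product mult_ac)
  qed
qed

lemma cheb_span_const: "(\<lambda>x. a) \<in> (cheb_span :: (real ^ 'd::finite \<Rightarrow> complex) set)"
proof -
  have "(\<lambda>x. a * complex_of_real (cheb_prod 0 (x :: real ^ 'd))) \<in> cheb_span"
    by (intro cheb_span_cmult cheb_span_cheb_prod)
  then show ?thesis
    by (simp add: cheb_prod_def)
qed

lemma cheb_span_coord:
  "(\<lambda>x. complex_of_real (x $ j)) \<in> (cheb_span :: (real ^ 'd::finite \<Rightarrow> complex) set)"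
proof (rule cheb_span_cong)
  show "(\<lambda>x. complex_of_real (cheb_prod (axis j 1) x)) \<in> cheb_span"
    by (rule cheb_span_cheb_prod)
  show "complex_of_real (x $ j) = complex_of_real (cheb_prod (axis j 1) x)" if "x \<in> cube"
    for x :: "real ^ 'd"
  proof -
    have x: "\<bar>x $ j\<bar> \<le> 1"
      using that by (auto simp: cube_def abs_le_iff minus_le_iff)
    have "cheb_prod (axis j 1) x = (\<Prod>i\<in>UNIV. if i = j then x $ j else 1)"
      unfolding cheb_prod_def
      by (rule prod.cong) (use cheb_1[OF x] in \<open>auto simp: axis_def\<close>)
    then show ?thesis
      by simp
  qed
qed

text \<open>Induction over the generation of polynomial functions from linear forms and constants by
  sums and products. A linear form is a combination of coordinates, each of which is a
  \<open>cheb_prod\<close> with a unit vector as index.\<close>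

lemma cheb_span_real_polynomial_function:
  fixes p :: "real ^ 'd::finite \<Rightarrow> real"
  assumes "real_polynomial_function p"
  shows "(\<lambda>x. complex_of_real (p x)) \<in> cheb_span"
  using assms
proof induction
  case (linear f)
  then have "linear f"
    by (rule bounded_linear.linear)
  have f: "f x = (\<Sum>j\<in>UNIV. f (axis j 1) * x $ j)" for x
  proof -
    have "f x = f (\<Sum>j\<in>UNIV. x $ j *\<^sub>R axis j 1)"
      using basis_expansion[of x] by (simp only: scalar_mult_eq_scaleR)
    then show ?thesis
      using \<open>linear f\<close> by (simp add: linear_sum linear_scale mult.commute)
  qed
  show ?case
    by (subst f, unfold of_real_sum of_real_mult)
      (intro cheb_span_sum cheb_span_cmult cheb_span_coord)
qed (simp_all add: cheb_span_const cheb_span_add cheb_span_mult)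

lemma cheb_span_polynomial_function:
  fixes P :: "real ^ 'd::finite \<Rightarrow> complex"
  assumes "polynomial_function P"
  shows "P \<in> cheb_span"
proof -
  have "real_polynomial_function (Re \<circ> P)" "real_polynomial_function (Im \<circ> P)"
    using assms unfolding polynomial_function_def
    by (auto intro: bounded_linear_Re bounded_linear_Im)
  then have "(\<lambda>x. complex_of_real (Re (P x)) + \<i> * complex_of_real (Im (P x))) \<in> cheb_span"
    by (intro cheb_span_add cheb_span_cmult)
      (auto dest: cheb_span_real_polynomial_function)
  then show ?thesis
    by (simp flip: complex_eq)
qed

text \<open>Orthogonality leaves only the term \<open>\<gamma> = \<delta>\<close>. For
  \<open>\<delta>\<close> outside \<open>A\<close> the integral is 0, so the right-hand side is
  correct only with \<open>c \<delta> = 0\<close>.\<close>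

lemma cheb_expansion_integral:
  fixes P :: "real ^ 'd::finite \<Rightarrow> complex"
  assumes A: "finite A" and \<delta>: "\<delta> \<in> A \<or> c \<delta> = 0"
    and P: "\<And>x. x \<in> cube \<Longrightarrow> P x = (\<Sum>\<gamma>\<in>A. c \<gamma> * complex_of_real (cheb_prod \<gamma> x))"
  shows "(LINT x:cube|lborel. P x * complex_of_real (cheb_prod \<delta> x) * complex_of_real (cheb_weight x)) =
    c \<delta> * complex_of_real (\<Prod>j\<in>UNIV. if \<delta> $ j = 0 then pi else pi / 2)"
proof -
  define w where "w = (\<lambda>\<gamma> x. cheb_prod \<gamma> x * cheb_prod \<delta> x * cheb_weight (x :: real ^ 'd))"
  have w: "set_integrable lborel cube (\<lambda>x. complex_of_real (w \<gamma> x))" for \<gamma>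
    using cheb_prod_integrable[of \<gamma> \<delta>] unfolding w_def set_integrable_def
    by (simp flip: scaleR_conv_of_real of_real_mult del: of_real_mult)
      (simp add: scaleR_conv_of_real flip: of_real_mult)
  have "(LINT x:cube|lborel. P x * complex_of_real (cheb_prod \<delta> x) * complex_of_real (cheb_weight x)) =
      (LINT x:cube|lborel. \<Sum>\<gamma>\<in>A. c \<gamma> * complex_of_real (w \<gamma> x))"
    unfolding set_lebesgue_integral_def
    by (intro Bochner_Integration.integral_cong)
      (auto simp: indicator_def P sum_distrib_right w_def mult.assoc)
  also have "\<dots> = (\<Sum>\<gamma>\<in>A. c \<gamma> * (LINT x:cube|lborel. complex_of_real (w \<gamma> x)))"
    using w unfolding set_lebesgue_integral_def set_integrable_def
    by (simp add: scaleR_sum_right Bochner_Integration.integral_sum integrable_mult_right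
      flip: mult_scaleR_right)
  also have "\<dots> = (\<Sum>\<gamma>\<in>A. c \<gamma> * complex_of_real (LINT x:cube|lborel. w \<gamma> x))"
    by (simp add: set_integral_complex_of_real)
  also have "\<dots> = (\<Sum>\<gamma>\<in>A. if \<gamma> = \<delta>
      then c \<delta> * complex_of_real (\<Prod>j\<in>UNIV. if \<delta> $ j = 0 then pi else pi / 2) else 0)"
  proof (rule sum.cong[OF refl])
    fix \<gamma>
    show "c \<gamma> * complex_of_real (LINT x:cube|lborel. w \<gamma> x) = (if \<gamma> = \<delta>
      then c \<delta> * complex_of_real (\<Prod>j\<in>UNIV. if \<delta> $ j = 0 then pi else pi / 2) else 0)"
    proof (cases "\<gamma> = \<delta>")
      case False
      then obtain j where "\<gamma> $ j \<noteq> \<delta> $ j"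
        by (auto simp: vec_eq_iff)
      then have "(LINT x:cube|lborel. w \<gamma> x) = 0"
        unfolding w_def cheb_prod_integral by (intro prod_zero bexI[of _ j]) simp_all
      with False show ?thesis
        by simp
    qed (simp add: w_def cheb_prod_integral)
  qed
  finally show ?thesis
    using A \<delta> by auto
qed

section \<open>The cubature formula\<close>

lemma node_in_cube: "node n i \<in> cube"
  by (simp add: node_def cube_def)

theorem theorem2p10:
  fixes n :: "nat ^ 'd" and P :: "real ^ 'd \<Rightarrow> complex"
  assumes n_pos: "\<And>j. 1 \<le> n $ j"
    and n_coprime: "\<And>j k. j \<noteq> k \<Longrightarrow> coprime (n $ j) (n $ k)"
    and P_poly: "polynomial_function P"
    and P_orth: "\<And>\<gamma> :: nat ^ 'd. \<gamma> \<noteq> 0 \<Longrightarrow>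
       (\<exists>h :: nat ^ 'd. (\<forall>j. \<gamma> $ j = h $ j * n $ j) \<and> even (\<Sum>j\<in>UNIV. h $ j)) \<Longrightarrow>
       cheb_inner P (\<lambda>x. complex_of_real (cheb_prod \<gamma> x)) = 0"
  shows "complex_of_real (1 / pi ^ CARD('d)) *
           (LINT x:cube|lborel. P x * complex_of_real (cheb_weight x)) =
         (\<Sum>i\<in>node_idx n. complex_of_real (node_weight n i) * P (node n i))"
proof -
  define good where "good \<gamma> \<longleftrightarrow>
      (\<exists>h :: nat ^ 'd. (\<forall>j. \<gamma> $ j = h $ j * n $ j) \<and> even (\<Sum>j\<in>UNIV. h $ j))" for \<gamma>
  obtain A c where A: "finite A"
    and P: "\<And>x. x \<in> cube \<Longrightarrow> P x = (\<Sum>\<gamma>\<in>A. c \<gamma> * complex_of_real (cheb_prod \<gamma> x))"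
    using cheb_span_polynomial_function[OF P_poly] by (auto simp: cheb_span_def)
  have good_0: "good 0"
    unfolding good_def by (intro exI[of _ 0]) simp
  \<comment> \<open>The inner product is \<open>c \<gamma>\<close> times a nonzero constant, so its
    vanishing kills the coefficient.\<close>
  have coeff: "c \<gamma> = 0" if "\<gamma> \<in> A" "good \<gamma>" "\<gamma> \<noteq> 0" for \<gamma>
  proof -
    have "cheb_inner P (\<lambda>x. complex_of_real (cheb_prod \<gamma> x)) = 0"
      using that P_orth unfolding good_def by blast
    then show ?thesis
      using cheb_expansion_integral[OF A _ P, of \<gamma>] that(1) by (auto simp: cheb_inner_def split: if_splits)
  qed
  \<comment> \<open>Zero outside \<open>A\<close>, so that the coefficient at index 0 can be read
    off even if 0 is not in \<open>A\<close>.\<close>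
  define c' where "c' \<gamma> = (if \<gamma> \<in> A then c \<gamma> else 0)" for \<gamma>
  have P': "P x = (\<Sum>\<gamma>\<in>A. c' \<gamma> * complex_of_real (cheb_prod \<gamma> x))" if "x \<in> cube" for x
    unfolding P[OF that] by (rule sum.cong) (simp_all add: c'_def)
  have "complex_of_real (1 / pi ^ CARD('d)) *
      (LINT x:cube|lborel. P x * complex_of_real (cheb_weight x)) = c' 0"
    using cheb_expansion_integral[OF A _ P', of 0] by (auto simp: cheb_prod_def c'_def)
  also have "\<dots> = (\<Sum>\<gamma>\<in>A. if \<gamma> = 0 then c \<gamma> else 0)"
    using A by (auto simp: c'_def)
  \<comment> \<open>Index 0 is good, and every other good index in \<open>A\<close> has coefficient
    0, so both sums reduce to the same term.\<close>
  also have "\<dots> = (\<Sum>\<gamma>\<in>A. c \<gamma> * complex_of_real (if good \<gamma> then 1 else 0))"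
    by (rule sum.cong) (auto simp: coeff good_0)
  also have "\<dots> = (\<Sum>\<gamma>\<in>A. c \<gamma> * complex_of_real
      (\<Sum>i\<in>node_idx n. node_weight n i * cheb_prod \<gamma> (node n i)))"
    unfolding good_def sum_node_idx_cheb_prod[OF n_pos] ..
  also have "\<dots> = (\<Sum>\<gamma>\<in>A. \<Sum>i\<in>node_idx n.
      complex_of_real (node_weight n i) * (c \<gamma> * complex_of_real (cheb_prod \<gamma> (node n i))))"
    by (simp add: sum_distrib_left mult_ac)
  also have "\<dots> = (\<Sum>i\<in>node_idx n. complex_of_real (node_weight n i) * P (node n i))"
    \<comment> \<open>After the exchange of sums, the inner sum is the expansion of \<open>P\<close>
      at a node, valid because nodes lie in the cube.\<close>
    by (subst sum.swap) (simp add: P node_in_cube sum_distrib_left)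
  finally show ?thesis .
qed

end
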